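(* Consider a $J$-sided convex polygon in the plane whose $j$-th edge has length $\ell_j>0$ and unit outward normal vector $(\mathcal N_1^j,\mathcal N_2^j)$, $j=1,\dots,J$. Let $\omega_1,\dots,\omega_L$ be positive numbers with $\sum_{i=1}^L\omega_i=1$. If $\mathbf U^{ij}\in\mathcal G$ for $i=1,\dots,L$, $j=1,\dots,J$ satisfy the 2D "discrete divergence-free" condition over the polygon $$\sum_{j=1}^J\left[\sum_{i=1}^L\omega_i\left(B_1^{ij}\mathcal N_1^j+B_2^{ij}\mathcal N_2^j\right)\right]\ell_j=0,$$ then for all $\alpha\ge c=1$, $$\frac{1}{\sum_{j=1}^J\ell_j}\sum_{j=1}^J\left[\sum_{i=1}^L\omega_i\bigg(\mathbf U^{ij}-\alpha^{-1}\Big(\mathbf F_1(\mathbf U^{ij})\mathcal N_1^j+\mathbf F_2(\mathbf U^{ij})\mathcal N_2^j\Big)\bigg)\right]\ell_j\in\mathcal G.$$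
   Context: Fix the adiabatic index $\Gamma\in(1,2]$ (equation of state $p=(\Gamma-1)\rho e$; speed of light $c=1$). For primitive variables $\mathbf V=(\rho,\mathbf v,\mathbf B,p)$ with $\rho,p>0$, $\mathbf v,\mathbf B\in\mathbb R^3$, $|\mathbf v|<1$, put $W=(1-|\mathbf v|^2)^{-1/2}$, $e=\frac{p}{(\Gamma-1)\rho}$, $h=1+e+\frac p\rho$, $p_m=\frac12\big(W^{-2}|\mathbf B|^2+(\mathbf v\cdot\mathbf B)^2\big)$, $p_{tot}=p+p_m$. The associated conservative vector is $\mathbf U(\mathbf V)=(D,\mathbf m,\mathbf B,E)^\top\in\mathbb R^8$ with $D=\rho W$, $\mathbf m=\rho hW^2\mathbf v+|\mathbf B|^2\mathbf v-(\mathbf v\cdot\mathbf B)\mathbf B$, $E=\rho hW^2-p_{tot}+|\mathbf B|^2$. The admissible state set is $\mathcal G=\{\mathbf U(\mathbf V): \rho>0,\ p>0,\ |\mathbf v|<1,\ \mathbf B\in\mathbb R^3\}$. Each $\mathbf U\in\mathcal G$ determines its primitive variables, and for $\mathbf U\in\mathcal G$ and $k\in\{1,2,3\}$ the flux is $$\mathbf F_k(\mathbf U)=\Big(Dv_k,\ v_k\mathbf m-B_k\big(W^{-2}\mathbf B+(\mathbf v\cdot\mathbf B)\mathbf v\big)+p_{tot}\mathbf e_k,\ v_k\mathbf B-B_k\mathbf v,\ m_k\Big)^\top,$$ with $\mathbf e_k$ the $k$-th row of the $3\times3$ identity matrix. $B_k^{ij}$ denotes the $k$-th component of the magnetic field of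 $\mathbf U^{ij}$. *)

theory Defs
  imports "HOL-Analysis.Analysis"
begin

section \<open>Ideal relativistic magnetohydrodynamics\<close>

text \<open>
  Primitive vectors are written \<open>(\<rho>, v, B, p)\<close> and conservative vectors \<open>(D, m, B, E)\<close>.
  Both live in the eight-dimensional real vector space below, used in place of
  \<open>real ^ 8\<close> so that the vector-valued blocks stay visible; addition and scaling are
  componentwise. Units are such that the speed of light is 1, and \<open>\<Gamma>\<close> is the adiabatic
  index.
\<close>

type_synonym state = "real \<times> (real ^ 3) \<times> (real ^ 3) \<times> real"

definition lorentz :: "real ^ 3 \<Rightarrow> real" where
  "lorentz v = 1 / sqrt (1 - (norm v)\<^sup>2)"

definition internal_energy :: "real \<Rightarrow> real \<Rightarrow> real \<Rightarrow> real" where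
  "internal_energy \<Gamma> \<rho> p = p / ((\<Gamma> - 1) * \<rho>)"

definition enthalpy :: "real \<Rightarrow> real \<Rightarrow> real \<Rightarrow> real" where
  "enthalpy \<Gamma> \<rho> p = 1 + internal_energy \<Gamma> \<rho> p + p / \<rho>"

definition p_mag :: "real ^ 3 \<Rightarrow> real ^ 3 \<Rightarrow> real" where
  "p_mag v B = ((norm B)\<^sup>2 / (lorentz v)\<^sup>2 + (v \<bullet> B)\<^sup>2) / 2"

definition p_tot :: "real ^ 3 \<Rightarrow> real ^ 3 \<Rightarrow> real \<Rightarrow> real" where
  "p_tot v B p = p + p_mag v B"

definition prim_admissible :: "state set" where
  "prim_admissible = {(\<rho>, v, B, p). \<rho> > 0 \<and> p > 0 \<and> norm v < 1}"

definition conservative :: "real \<Rightarrow> state \<Rightarrow> state" where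
  "conservative \<Gamma> = (\<lambda>(\<rho>, v, B, p).
     (let W = lorentz v; h = enthalpy \<Gamma> \<rho> p in
       (\<rho> * W,
        (\<rho> * h * W\<^sup>2) *\<^sub>R v + (norm B)\<^sup>2 *\<^sub>R v - (v \<bullet> B) *\<^sub>R B,
        B,
        \<rho> * h * W\<^sup>2 - p_tot v B p + (norm B)\<^sup>2)))"

definition admissible :: "real \<Rightarrow> state set" where
  "admissible \<Gamma> = conservative \<Gamma> ` prim_admissible"

text \<open>
  For \<open>1 < \<Gamma> \<le> 2\<close> an admissible conservative vector has exactly one admissible primitive
  vector, so on \<open>admissible \<Gamma>\<close> the following is the inverse of \<open>conservative \<Gamma>\<close>.
\<close>

definition primitive :: "real \<Rightarrow> state \<Rightarrow> state" where
  "primitive \<Gamma> = inv_into prim_admissible (conservative \<Gamma>)"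

definition magnetic :: "state \<Rightarrow> real ^ 3" where
  "magnetic = (\<lambda>(D, m, B, E). B)"

definition flux :: "real \<Rightarrow> 3 \<Rightarrow> state \<Rightarrow> state" where
  "flux \<Gamma> k U =
     (case U of (D, m, B, E) \<Rightarrow> case primitive \<Gamma> U of (\<rho>, v, _, p) \<Rightarrow>
       (D * v $ k,
        (v $ k) *\<^sub>R m - (B $ k) *\<^sub>R ((1 / (lorentz v)\<^sup>2) *\<^sub>R B + (v \<bullet> B) *\<^sub>R v)
          + p_tot v B p *\<^sub>R axis k 1,
        (v $ k) *\<^sub>R B - (B $ k) *\<^sub>R v,
        m $ k))"

section \<open>Convex polygons\<close>

text \<open>
  A polygon with \<open>J\<close> sides is given by its vertices \<open>x 0, \<dots>, x (J - 1)\<close> in cyclic order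
  (of either orientation); its \<open>j\<close>-th edge joins \<open>x j\<close> to the cyclically next vertex. It is
  convex if every edge lies on a line having all the other vertices strictly on one and
  the same side. For \<open>J \<ge> 3\<close> this forces the vertices to be distinct and no two edges to be
  collinear, so that \<open>J\<close> is the number of sides of the convex hull of the vertices.
\<close>

definition next_vertex :: "nat \<Rightarrow> (nat \<Rightarrow> real ^ 2) \<Rightarrow> nat \<Rightarrow> real ^ 2" where
  "next_vertex J x j = x (Suc j mod J)"

definition convex_polygon :: "nat \<Rightarrow> (nat \<Rightarrow> real ^ 2) \<Rightarrow> bool" where
  "convex_polygon J x \<longleftrightarrow> J \<ge> 3 \<and>
     (\<forall>j<J. \<exists>a. a \<bullet> (next_vertex J x j - x j) = 0 \<and>
        (\<forall>k<J. k \<noteq> j \<and> k \<noteq> Suc j mod J \<longrightarrow> a \<bullet> (x k - x j) < 0))"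

definition edge_length :: "nat \<Rightarrow> (nat \<Rightarrow> real ^ 2) \<Rightarrow> nat \<Rightarrow> real" where
  "edge_length J x j = dist (x j) (next_vertex J x j)"

definition unit_outward_normal :: "nat \<Rightarrow> (nat \<Rightarrow> real ^ 2) \<Rightarrow> nat \<Rightarrow> real ^ 2 \<Rightarrow> bool" where
  "unit_outward_normal J x j n \<longleftrightarrow>
     norm n = 1 \<and> n \<bullet> (next_vertex J x j - x j) = 0 \<and>
     (\<forall>y \<in> convex hull (x ` {..<J}). n \<bullet> (y - x j) \<le> 0)"

end

theory Submission imports Defs begin

text \<open>
  Admissibility is nonlinear in \<open>U\<close>, but it can be expressed by inequalities that are affine
  in \<open>U\<close>, and this is what makes averages tractable. For a test velocity \<open>w\<close> with
  \<open>norm w < 1\<close> and a test field \<open>Bs\<close>, let \<open>test_functional w Bs\<close> be the linear functional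
  defined below. Then \<open>(D, m, B, E)\<close> is admissible as soon as \<open>D > 0\<close> and
  \<open>test_functional w Bs (D, m, B, E) + p_mag w Bs > 0\<close> for all \<open>w\<close> and \<open>Bs\<close>
  (\<open>admissible_if_test_functional_pos\<close>). The proof looks for primitive variables along the
  curve of all velocities that are compatible with \<open>m\<close> and \<open>B\<close>, parametrised by
  \<open>\<xi> = \<rho> h W\<^sup>2\<close>. At one point of the curve the pressure is zero; the inequality tested with
  the velocity of that point and with \<open>B\<close> itself says that the energy there is below
  \<open>E\<close>. Beyond that point the pressure is positive and the energy tends to infinity, so it
  takes the value \<open>E\<close>.

  Conversely, admissible states satisfy a stronger inequality which involves the flux in any
  direction \<open>a\<close> with \<open>norm a \<le> 1\<close> (\<open>test_functional_flux_pos\<close>):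
  \<open>test_functional w Bs (U + F\<^sub>a) + (1 + a \<bullet> w) p_mag w Bs - (a \<bullet> B) (w \<bullet> Bs) > 0\<close>.
  Up to the factor \<open>lorentz w\<close> the left-hand side is \<open>J\<^sup>0 + a \<bullet> J\<close> for a four-vector
  \<open>J\<close>, and the claim is that \<open>J\<close> is timelike and points to the future. The vector
  \<open>J\<close> splits into a gas part, which is positive because \<open>\<Gamma> \<le> 2\<close> gives
  \<open>\<rho> h \<ge> \<rho> + 2 p\<close> (\<open>gas_contribution_pos\<close>), and a field part. The latter is, remarkably,
  the energy current measured by an observer with velocity \<open>w\<close> of the electromagnetic
  field obtained as the difference of the two ideal fields \<open>(- v \<times> B, B)\<close> and
  \<open>(- w \<times> Bs, Bs)\<close>; it is nonnegative by the dominant energy condition of Maxwell theory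
  (\<open>field_contribution_nonneg\<close>).

  In the theorem \<open>a = - N j / \<alpha>\<close>, extended by a zero third component. The two correction terms
  \<open>(a \<bullet> w) p_mag w Bs\<close> and \<open>(a \<bullet> B) (w \<bullet> Bs)\<close> drop out of the weighted sum: the first
  because the outward normals scaled by the edge lengths sum to zero
  (\<open>sum_scaled_normals_eq_0\<close>), the second by the discrete divergence-free condition. So the
  average satisfies the affine inequalities and is admissible. Since the flux is defined
  through the inverse of \<open>conservative \<Gamma>\<close>, the uniqueness of the primitive variables is also
  needed (\<open>inj_conservative\<close>); it holds because the energy increases strictly with
  \<open>\<xi>\<close> along the curve above.
\<close>

section \<open>The dominant energy condition for the electromagnetic field\<close>

text \<open>
  This is the product of two determinants, written as the determinant of the Gram matrix. It
  turns the products of triple products below into polynomials in inner products.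
\<close>

lemma triple_mult_triple:
  fixes x y z a b c :: "real^3"
  shows "(cross3 x y \<bullet> z) * (cross3 a b \<bullet> c) =
      (x \<bullet> a) * ((y \<bullet> b) * (z \<bullet> c) - (y \<bullet> c) * (z \<bullet> b))
    - (x \<bullet> b) * ((y \<bullet> a) * (z \<bullet> c) - (y \<bullet> c) * (z \<bullet> a))
    + (x \<bullet> c) * ((y \<bullet> a) * (z \<bullet> b) - (y \<bullet> b) * (z \<bullet> a))"
  unfolding cross3_def inner_vec_def sum_3 by simp algebra

lemma cross_cross_dot:
  fixes x y z u :: "real^3"
  shows "cross3 (cross3 x y) z \<bullet> u = (x \<bullet> z) * (y \<bullet> u) - (y \<bullet> z) * (x \<bullet> u)"
  unfolding cross3_def inner_vec_def sum_3 by simp algebra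

lemma dot_cross_cross:
  fixes x y z u :: "real^3"
  shows "u \<bullet> cross3 (cross3 x y) z = (x \<bullet> z) * (y \<bullet> u) - (y \<bullet> z) * (x \<bullet> u)"
  using cross_cross_dot by (simp add: inner_commute)

text \<open>
  The expression is the electromagnetic stress-energy tensor \<open>T\<close> contracted with the
  vectors \<open>(1, - a)\<close> and \<open>(1, w)\<close>, with energy density \<open>e\<close> and Poynting vector \<open>S\<close>. The
  current \<open>(Q0, Q)\<close> that an observer of velocity \<open>w\<close> sees has \<open>Q0 = e - S \<bullet> w\<close> and the
  spatial part \<open>Q\<close> below. Since \<open>T\<close> squares to a multiple of the metric (the Rainich
  identity), \<open>Q0\<^sup>2 - Q \<bullet> Q = (1 - w \<bullet> w) (e\<^sup>2 - S \<bullet> S)\<close>, and \<open>S \<bullet> S \<le> e\<^sup>2\<close>; hence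
  \<open>norm Q \<le> Q0\<close>.
\<close>

lemma electromagnetic_dominant_energy:
  fixes E B a w :: "real^3"
  assumes "norm a \<le> 1" "norm w \<le> 1"
  defines "e \<equiv> (E \<bullet> E + B \<bullet> B) / 2" and "S \<equiv> cross3 E B"
  shows "0 \<le> e * (1 - a \<bullet> w) + S \<bullet> (a - w) + (E \<bullet> a) * (E \<bullet> w) + (B \<bullet> a) * (B \<bullet> w)"
proof -
  define Q where "Q = S - e *\<^sub>R w + (E \<bullet> w) *\<^sub>R E + (B \<bullet> w) *\<^sub>R B"
  have SS: "S \<bullet> S = (E \<bullet> E) * (B \<bullet> B) - (E \<bullet> B)\<^sup>2"
    unfolding S_def by (simp add: dot_cross inner_commute power2_eq_square) 
  have "4 * (e\<^sup>2 - S \<bullet> S) = (E \<bullet> E - B \<bullet> B)\<^sup>2 + 4 * (E \<bullet> B)\<^sup>2"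
    unfolding SS e_def by (simp add: power2_eq_square field_simps)
  then have ge: "S \<bullet> S \<le> e\<^sup>2"
    by (smt (verit) zero_le_power2)
  have e0: "e \<ge> 0" by (simp add: e_def)
  have "norm S \<le> e"
    using ge e0 by (simp add: norm_le_square)
  then have Q0: "0 \<le> e - S \<bullet> w"
    using norm_cauchy_schwarz[of S w] assms(2) mult_left_mono[of "norm w" 1 "norm S"] by simp
  have ww: "w \<bullet> w \<le> 1" using assms(2) by (simp add: norm_le_square)
  have SE: "S \<bullet> E = 0" "S \<bullet> B = 0"
    by (simp_all add: S_def dot_cross_self inner_commute[of _ E])
  have QQ: "Q \<bullet> Q = S \<bullet> S + e\<^sup>2 * (w \<bullet> w) + (E \<bullet> w)\<^sup>2 * (E \<bullet> E) + (B \<bullet> w)\<^sup>2 * (B \<bullet> B)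
     - 2 * e * (S \<bullet> w) - 2 * e * ((E \<bullet> w)\<^sup>2 + (B \<bullet> w)\<^sup>2) + 2 * (E \<bullet> w) * (B \<bullet> w) * (E \<bullet> B)"
    unfolding Q_def using SE
    by (simp add: inner_simps inner_commute power2_eq_square algebra_simps)
  have Sw: "(S \<bullet> w)\<^sup>2 = (E \<bullet> E) * ((B \<bullet> B) * (w \<bullet> w) - (B \<bullet> w)\<^sup>2)
      - (E \<bullet> B) * ((E \<bullet> B) * (w \<bullet> w) - (B \<bullet> w) * (E \<bullet> w))
      + (E \<bullet> w) * ((E \<bullet> B) * (B \<bullet> w) - (B \<bullet> B) * (E \<bullet> w))"
    unfolding power2_eq_square S_def triple_mult_triple by (simp add: inner_commute)
  have "(e - S \<bullet> w)\<^sup>2 - Q \<bullet> Q = (1 - w \<bullet> w) * (e\<^sup>2 - S \<bullet> S)"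
    unfolding QQ power2_diff Sw unfolding SS e_def
    by (simp add: power2_eq_square field_simps)
  then have "Q \<bullet> Q \<le> (e - S \<bullet> w)\<^sup>2"
    using ge ww mult_nonneg_nonneg[of "1 - w \<bullet> w" "e\<^sup>2 - S \<bullet> S"] by linarith
  then have "norm Q \<le> e - S \<bullet> w"
    using Q0 by (simp add: norm_le_square)
  moreover have "- (Q \<bullet> a) \<le> norm Q"
    using norm_cauchy_schwarz[of "-Q" a] assms(1) mult_left_mono[of "norm a" 1 "norm Q"] by simp
  ultimately have "0 \<le> e - S \<bullet> w + Q \<bullet> a" by simp
  also have "\<dots> = e * (1 - a \<bullet> w) + S \<bullet> (a - w) + (E \<bullet> a) * (E \<bullet> w) + (B \<bullet> a) * (B \<bullet> w)"
    unfolding Q_def by (simp add: inner_simps inner_commute algebra_simps)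
  finally show ?thesis .
qed

text \<open>
  Here \<open>q\<close> and \<open>qs\<close> are the magnetic pressures of \<open>(v, B)\<close> and \<open>(w, Bs)\<close>, and \<open>m\<close> is the
  momentum of the field. All terms are those of the energy current of the difference field
  \<open>(E, H)\<close>: the terms quadratic in \<open>B\<close> come from the state, the mixed ones from the linear
  functional applied to the induction part of the state and of its flux, and the terms
  quadratic in \<open>Bs\<close> are \<open>(1 + a \<bullet> w) qs\<close>. The summand \<open>(a \<bullet> B) (w \<bullet> Bs)\<close> is needed to
  make the mixed terms covariant: the magnetic field and its flux are components of an
  antisymmetric tensor, and it supplies the time component of the contraction with the test
  field.
\<close>

lemma field_contribution_nonneg:
  fixes v w B Bs a :: "real^3"
  assumes "norm a \<le> 1" "norm w \<le> 1"
  defines "q \<equiv> ((B \<bullet> B) * (1 - v \<bullet> v) + (v \<bullet> B)\<^sup>2) / 2"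
    and "qs \<equiv> ((Bs \<bullet> Bs) * (1 - w \<bullet> w) + (w \<bullet> Bs)\<^sup>2) / 2"
    and "m \<equiv> (B \<bullet> B) *\<^sub>R v - (v \<bullet> B) *\<^sub>R B"
    and "b \<equiv> (1 - v \<bullet> v) *\<^sub>R B + (v \<bullet> B) *\<^sub>R v"
    and "bs \<equiv> (1 - w \<bullet> w) *\<^sub>R Bs + (w \<bullet> Bs) *\<^sub>R w"
  shows "0 \<le> B \<bullet> B - q + a \<bullet> m
     - (m + (a \<bullet> v) *\<^sub>R m - (a \<bullet> B) *\<^sub>R b + q *\<^sub>R a) \<bullet> w
     - (B + (a \<bullet> v) *\<^sub>R B - (a \<bullet> B) *\<^sub>R v) \<bullet> bs
     + (1 + a \<bullet> w) * qs - (a \<bullet> B) * (w \<bullet> Bs)" (is "0 \<le> ?L")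
proof -
  define E where "E = cross3 w Bs - cross3 v B"
  define H where "H = B - Bs"
  have Ew: "E \<bullet> w = - (cross3 v B \<bullet> w)"
    by (simp add: E_def inner_simps dot_cross_self)
  have "(E \<bullet> a) * (E \<bullet> w) = (cross3 v B \<bullet> a) * (cross3 v B \<bullet> w) - (cross3 w Bs \<bullet> a) * (cross3 v B \<bullet> w)"
    unfolding Ew by (simp add: E_def inner_simps algebra_simps)
  note EE = this[unfolded triple_mult_triple]
  \<comment> \<open>The density of the energy current, i.e. the part without \<open>a\<close>.\<close>
  have energy: "B \<bullet> B - q - m \<bullet> w - B \<bullet> bs + qs = (E \<bullet> E + H \<bullet> H) / 2 - cross3 E H \<bullet> w"
    unfolding E_def H_def q_def qs_def m_def bs_def Cross3.left_diff_distrib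
    by (simp add: inner_simps dot_cross cross_cross_dot dot_cross_cross inner_commute power2_eq_square field_simps)
  \<comment> \<open>The spatial part of the current in the direction \<open>a\<close>.\<close>
  have flux: "a \<bullet> m - ((a \<bullet> v) *\<^sub>R m - (a \<bullet> B) *\<^sub>R b + q *\<^sub>R a) \<bullet> w
      - ((a \<bullet> v) *\<^sub>R B - (a \<bullet> B) *\<^sub>R v) \<bullet> bs + (a \<bullet> w) * qs - (a \<bullet> B) * (w \<bullet> Bs)
    = - ((E \<bullet> E + H \<bullet> H) / 2) * (a \<bullet> w) + cross3 E H \<bullet> a + (E \<bullet> a) * (E \<bullet> w) + (H \<bullet> a) * (H \<bullet> w)"
    unfolding EE unfolding E_def H_def q_def qs_def m_def b_def bs_def Cross3.left_diff_distrib
    by (simp add: inner_simps dot_cross cross_cross_dot dot_cross_cross inner_commute power2_eq_square field_simps)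
  have "?L = (B \<bullet> B - q - m \<bullet> w - B \<bullet> bs + qs) + (a \<bullet> m - ((a \<bullet> v) *\<^sub>R m - (a \<bullet> B) *\<^sub>R b + q *\<^sub>R a) \<bullet> w
      - ((a \<bullet> v) *\<^sub>R B - (a \<bullet> B) *\<^sub>R v) \<bullet> bs + (a \<bullet> w) * qs - (a \<bullet> B) * (w \<bullet> Bs))"
    by (simp add: inner_add_left inner_diff_left distrib_right)
  also have "\<dots> = (E \<bullet> E + H \<bullet> H) / 2 * (1 - a \<bullet> w) + cross3 E H \<bullet> (a - w)
      + (E \<bullet> a) * (E \<bullet> w) + (H \<bullet> a) * (H \<bullet> w)"
    unfolding energy flux by (simp add: inner_diff_right right_diff_distrib)
  finally have "?L = (E \<bullet> E + H \<bullet> H) / 2 * (1 - a \<bullet> w) + cross3 E H \<bullet> (a - w)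
      + (E \<bullet> a) * (E \<bullet> w) + (H \<bullet> a) * (H \<bullet> w)" .
  then show ?thesis
    using electromagnetic_dominant_energy[OF assms(1,2), of E H] by simp
qed

section \<open>Positivity of the gas contribution\<close>

lemma inner_less_1:
  fixes v w :: "'a::real_inner"
  assumes "norm v < 1" "norm w \<le> 1"
  shows "v \<bullet> w < 1"
proof -
  have "norm v * norm w \<le> norm v" using assms by (simp add: mult_left_le)
  then show ?thesis using norm_cauchy_schwarz[of v w] assms by linarith
qed

lemma one_plus_inner_pos:
  fixes v w :: "'a::real_inner"
  assumes "norm v < 1" "norm w \<le> 1"
  shows "0 < 1 + w \<bullet> v"
  using inner_less_1[of v "-w"] assms by (simp add: inner_commute)

lemma one_minus_inner_self_pos: 
  fixes v :: "'a::real_inner"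
  assumes "norm v < 1" shows "0 < 1 - v \<bullet> v"
  using inner_less_1[of v v] assms by simp

text \<open>
  The relative Lorentz factor of two observers is at least 1. By the inequality between the
  geometric and the arithmetic mean the left-hand side is at most
  \<open>1 - (v \<bullet> v + w \<bullet> w) / 2\<close>, and \<open>2 (v \<bullet> w) \<le> v \<bullet> v + w \<bullet> w\<close>.
\<close>

lemma lorentz_reverse_Cauchy_Schwarz:
  fixes v w :: "'a::real_inner"
  assumes "norm v < 1" "norm w < 1"
  shows "sqrt (1 - v \<bullet> v) * sqrt (1 - w \<bullet> w) \<le> 1 - v \<bullet> w"
proof -
  have "2 * sqrt (1 - v \<bullet> v) * sqrt (1 - w \<bullet> w) \<le> (sqrt (1 - v \<bullet> v))\<^sup>2 + (sqrt (1 - w \<bullet> w))\<^sup>2"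
    by (rule sum_squares_bound)
  moreover have "0 \<le> (v - w) \<bullet> (v - w)" by simp
  then have "2 * (v \<bullet> w) \<le> v \<bullet> v + w \<bullet> w"
    by (simp add: inner_simps inner_commute)
  ultimately show ?thesis
    using one_minus_inner_self_pos[OF assms(1)] one_minus_inner_self_pos[OF assms(2)] by simp
qed

text \<open>
  Reflecting the timelike vector \<open>(1, w)\<close> about the axis spanned by \<open>(1, v)\<close> gives
  \<open>(s - 1, s v - w)\<close> with \<open>s = 2 (1 - v \<bullet> w) / (1 - v \<bullet> v)\<close>. Reflections preserve the
  Minkowski norm, so this vector is again timelike and future-directed, and its product with the
  causal vector \<open>(1, - a)\<close> has a strict sign.
\<close>

lemma timelike_reflection:
  fixes a v w :: "'a::real_inner"
  assumes "norm v < 1" "norm w < 1" "norm a \<le> 1"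
  shows "(1 - v \<bullet> v) * (1 + a \<bullet> w) < 2 * (1 - v \<bullet> w) * (1 + a \<bullet> v)"
proof -
  define c where "c = 1 - v \<bullet> v"
  have c: "0 < c" using assms(1) one_minus_inner_self_pos c_def by auto
  define s where "s = 2 * (1 - v \<bullet> w) / c"
  have sc: "s * c = 2 * (1 - v \<bullet> w)" using c by (simp add: s_def)
  have "0 \<le> (v - w) \<bullet> (v - w)" by simp
  then have "c \<le> 2 * (1 - v \<bullet> w)"
    using one_minus_inner_self_pos[OF assms(2)] by (simp add: c_def inner_simps inner_commute)
  then have s1: "1 \<le> s" using c by (simp add: s_def)
  have "(s - 1)\<^sup>2 - (s *\<^sub>R v - w) \<bullet> (s *\<^sub>R v - w) = s * (s * c) - s * (2 * (1 - v \<bullet> w)) + (1 - w \<bullet> w)"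
    unfolding c_def by (simp add: inner_simps inner_commute power2_eq_square algebra_simps)
  also have "\<dots> > 0" using one_minus_inner_self_pos[OF assms(2)] by (simp add: sc)
  finally have less: "(s *\<^sub>R v - w) \<bullet> (s *\<^sub>R v - w) < (s - 1)\<^sup>2" by simp
  have "s \<noteq> 1"
  proof
    assume "s = 1"
    then have "(v - w) \<bullet> (v - w) < 0" using less by simp
    then show False using inner_ge_zero[of "v - w"] by linarith
  qed
  then have "norm (s *\<^sub>R v - w) < s - 1"
    using s1 less by (simp add: norm_lt_square)
  moreover have "- (a \<bullet> (s *\<^sub>R v - w)) \<le> norm (s *\<^sub>R v - w)"
    using norm_cauchy_schwarz[of "-a" "s *\<^sub>R v - w"] assms(3) 
      mult_right_mono[of "norm a" 1 "norm (s *\<^sub>R v - w)"] by simp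
  ultimately have "0 < c * (s - 1 + a \<bullet> (s *\<^sub>R v - w))" using c by simp
  also have "\<dots> = (s * c) * (1 + a \<bullet> v) - c * (1 + a \<bullet> w)"
    by (simp add: inner_simps algebra_simps)
  finally have "c * (1 + a \<bullet> w) < s * c * (1 + a \<bullet> v)" by simp
  then show ?thesis unfolding sc unfolding c_def .
qed

text \<open>
  With \<open>D sqrt (1 - v \<bullet> v) = \<rho>\<close> and \<open>\<xi> (1 - v \<bullet> v) = \<rho> h\<close> the last assumption is
  \<open>\<rho> h \<ge> \<rho> + 2 p\<close>. The rest mass \<open>\<rho>\<close> is
  handled by \<open>lorentz_reverse_Cauchy_Schwarz\<close> and the remaining \<open>2 p\<close> by
  \<open>timelike_reflection\<close>. The second estimate is strict even if \<open>norm a = 1\<close>, so that no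
  strictness is lost for \<open>\<alpha> = 1\<close>.
\<close>

lemma gas_contribution_pos:
  fixes a v w :: "'a::real_inner"
  assumes v: "norm v < 1" and w: "norm w < 1" and a: "norm a \<le> 1"
    and "0 < p" "0 \<le> D" and \<xi>: "D * sqrt (1 - v \<bullet> v) + 2 * p \<le> \<xi> * (1 - v \<bullet> v)"
  shows "0 < (1 + a \<bullet> v) * (\<xi> * (1 - v \<bullet> w) - D * sqrt (1 - w \<bullet> w)) - p * (1 + a \<bullet> w)"
proof -
  define g where "g = sqrt (1 - v \<bullet> v)"
  define c where "c = 1 - v \<bullet> v"
  have c: "0 < c" using one_minus_inner_self_pos[OF v] by (simp add: c_def)
  have g: "g * g = c" "0 \<le> g" using c by (simp_all add: g_def c_def)
  have vw: "0 < 1 - v \<bullet> w" using inner_less_1[of v w] v w by simp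
  have "D * c * sqrt (1 - w \<bullet> w) = D * g * (g * sqrt (1 - w \<bullet> w))"
    by (simp add: g(1)[symmetric])
  also have "\<dots> \<le> D * g * (1 - v \<bullet> w)"
    using lorentz_reverse_Cauchy_Schwarz[OF v w] g \<open>0 \<le> D\<close>
    by (intro mult_left_mono) (auto simp: g_def)
  finally have "D * c * sqrt (1 - w \<bullet> w) + 2 * p * (1 - v \<bullet> w) \<le> (D * g + 2 * p) * (1 - v \<bullet> w)"
    by (simp add: algebra_simps)
  also have "\<dots> \<le> \<xi> * c * (1 - v \<bullet> w)"
    using \<xi> vw by (intro mult_right_mono) (auto simp: g_def c_def)
  finally have "2 * p * (1 - v \<bullet> w) \<le> c * (\<xi> * (1 - v \<bullet> w) - D * sqrt (1 - w \<bullet> w))"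
    by (simp add: algebra_simps)
  then have "(1 + a \<bullet> v) * (2 * p * (1 - v \<bullet> w)) \<le> (1 + a \<bullet> v) * (c * (\<xi> * (1 - v \<bullet> w) - D * sqrt (1 - w \<bullet> w)))"
    using one_plus_inner_pos[OF v a] by (intro mult_left_mono) auto
  moreover have "p * (c * (1 + a \<bullet> w)) < p * (2 * (1 - v \<bullet> w) * (1 + a \<bullet> v))"
    using timelike_reflection[OF v w a] \<open>0 < p\<close> by (simp add: c_def)
  ultimately have "0 < c * ((1 + a \<bullet> v) * (\<xi> * (1 - v \<bullet> w) - D * sqrt (1 - w \<bullet> w)) - p * (1 + a \<bullet> w))"
    by (simp add: algebra_simps)
  then show ?thesis using c by (simp add: zero_less_mult_iff)
qed

section \<open>Parametrisation by the enthalpy, and uniqueness of the primitive variables\<close>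

text \<open>
  In the variable \<open>\<xi> = \<rho> h W\<^sup>2\<close> the momentum depends on \<open>\<xi>\<close>, \<open>v\<close> and \<open>B\<close> only and is linear in
  \<open>v\<close>; density and equation of state enter the energy only through the pressure.
\<close>

definition momentum :: "real \<Rightarrow> real^3 \<Rightarrow> real^3 \<Rightarrow> real^3" where
  "momentum \<xi> v B = (\<xi> + B \<bullet> B) *\<^sub>R v - (v \<bullet> B) *\<^sub>R B"

definition gas_pressure :: "real \<Rightarrow> real \<Rightarrow> real^3 \<Rightarrow> real \<Rightarrow> real" where
  "gas_pressure \<Gamma> D v \<xi> = (\<Gamma> - 1) / \<Gamma> * (\<xi> * (1 - v \<bullet> v) - D * sqrt (1 - v \<bullet> v))"

definition total_energy :: "real \<Rightarrow> real \<Rightarrow> real^3 \<Rightarrow> real^3 \<Rightarrow> real \<Rightarrow> real" where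
  "total_energy \<Gamma> D v B \<xi> = \<xi> - gas_pressure \<Gamma> D v \<xi> + ((B \<bullet> B) * (1 + v \<bullet> v) - (v \<bullet> B)\<^sup>2) / 2"

lemma p_mag_eq:
  assumes "norm v < 1"
  shows "p_mag v B = ((B \<bullet> B) * (1 - v \<bullet> v) + (v \<bullet> B)\<^sup>2) / 2"
  using one_minus_inner_self_pos[OF assms]
  by (simp add: p_mag_def lorentz_def power2_norm_eq_inner power_divide)

lemma conservative_eq:
  assumes "1 < \<Gamma>" "0 < \<rho>" "0 < p" and v: "norm v < 1"
  defines "D \<equiv> \<rho> * lorentz v" and "\<xi> \<equiv> \<rho> * enthalpy \<Gamma> \<rho> p * (lorentz v)\<^sup>2"
  shows "conservative \<Gamma> (\<rho>, v, B, p) = (D, momentum \<xi> v B, B, total_energy \<Gamma> D v B \<xi>)"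
    and "gas_pressure \<Gamma> D v \<xi> = p"
    and "D * sqrt (1 - v \<bullet> v) = \<rho>"
    and "\<xi> * (1 - v \<bullet> v) = \<rho> + \<Gamma> / (\<Gamma> - 1) * p"
    and "0 < D" and "0 < \<xi>"
proof -
  have c: "0 < 1 - v \<bullet> v" by (rule one_minus_inner_self_pos[OF v])
  have W: "lorentz v = 1 / sqrt (1 - v \<bullet> v)" by (simp add: lorentz_def power2_norm_eq_inner)
  show D: "D * sqrt (1 - v \<bullet> v) = \<rho>" using c by (simp add: D_def W)
  show "0 < D" using c assms(2) by (simp add: D_def W)
  have "\<rho> * enthalpy \<Gamma> \<rho> p = \<rho> + \<Gamma> / (\<Gamma> - 1) * p"
    using assms(1,2) by (simp add: enthalpy_def internal_energy_def field_simps)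
  then show \<xi>: "\<xi> * (1 - v \<bullet> v) = \<rho> + \<Gamma> / (\<Gamma> - 1) * p"
    using c by (simp add: \<xi>_def W power_divide)
  moreover have "0 < \<rho> + \<Gamma> / (\<Gamma> - 1) * p" using assms(1-3) by (simp add: add_pos_pos)
  ultimately show "0 < \<xi>" using c by (metis zero_less_mult_pos2)
  show p: "gas_pressure \<Gamma> D v \<xi> = p"
    unfolding gas_pressure_def D \<xi> using assms(1) by simp
  show "conservative \<Gamma> (\<rho>, v, B, p) = (D, momentum \<xi> v B, B, total_energy \<Gamma> D v B \<xi>)"
    unfolding conservative_def Let_def total_energy_def p momentum_def p_tot_def p_mag_eq[OF v]
    by (simp add: D_def \<xi>_def power2_norm_eq_inner p_mag_eq[OF v] algebra_simps) (simp add: field_simps)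
qed

lemma admissibleI:
  assumes \<Gamma>: "1 < \<Gamma>" and D: "0 < D" and v: "norm v < 1" and p: "D < \<xi> * sqrt (1 - v \<bullet> v)"
  shows "(D, momentum \<xi> v B, B, total_energy \<Gamma> D v B \<xi>) \<in> admissible \<Gamma>"
proof -
  define \<rho> p where "\<rho> = D * sqrt (1 - v \<bullet> v)" and "p = gas_pressure \<Gamma> D v \<xi>"
  have c: "0 < 1 - v \<bullet> v" by (rule one_minus_inner_self_pos[OF v])
  have W: "lorentz v = 1 / sqrt (1 - v \<bullet> v)" by (simp add: lorentz_def power2_norm_eq_inner)
  have \<rho>: "0 < \<rho>" using c D by (simp add: \<rho>_def)
  have "D * sqrt (1 - v \<bullet> v) < \<xi> * sqrt (1 - v \<bullet> v) * sqrt (1 - v \<bullet> v)"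
    using p c by simp
  then have pp: "0 < p" using \<Gamma> c by (simp add: p_def gas_pressure_def mult.assoc)
  have D': "D = \<rho> * lorentz v" using c by (simp add: \<rho>_def W)
  have "\<xi> * (1 - v \<bullet> v) = \<rho> + \<Gamma> / (\<Gamma> - 1) * p"
    using \<Gamma> unfolding \<rho>_def p_def gas_pressure_def by simp
  moreover have "\<rho> * enthalpy \<Gamma> \<rho> p * (lorentz v)\<^sup>2 * (1 - v \<bullet> v) = \<rho> + \<Gamma> / (\<Gamma> - 1) * p"
    by (rule conservative_eq(4)[OF \<Gamma> \<rho> pp v])
  ultimately have \<xi>': "\<xi> = \<rho> * enthalpy \<Gamma> \<rho> p * (lorentz v)\<^sup>2"
    using c by (metis less_irrefl mult_right_cancel)
  have "conservative \<Gamma> (\<rho>, v, B, p) \<in> admissible \<Gamma>"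
    using \<rho> pp v by (auto simp: admissible_def prim_admissible_def)
  then show ?thesis
    unfolding conservative_eq(1)[OF \<Gamma> \<rho> pp v] D'[symmetric] \<xi>'[symmetric] .
qed

text \<open>
  The matrix \<open>\<xi> I + (B \<bullet> B) I - B B\<^sup>T\<close> of the map from velocity to momentum is therefore
  bounded below by \<open>\<xi> I\<close>.
\<close>

lemma magnetic_form_nonneg:
  fixes d B :: "'a::real_inner"
  shows "0 \<le> (B \<bullet> B) * (d \<bullet> d) - (d \<bullet> B)\<^sup>2"
  using Cauchy_Schwarz_ineq[of d B] by (simp add: mult.commute)

lemma momentum_eq_diff:
  assumes "momentum \<xi> v B = momentum \<xi>' v' B" and "0 \<le> \<xi>"
  shows "\<xi> * ((v - v') \<bullet> (v - v')) \<le> (\<xi>' - \<xi>) * (v' \<bullet> (v - v'))"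
proof -
  define d where "d = v - v'"
  have "(\<xi> + B \<bullet> B) *\<^sub>R d - (d \<bullet> B) *\<^sub>R B = (\<xi>' - \<xi>) *\<^sub>R v'"
    using assms(1) by (simp add: momentum_def d_def algebra_simps)
  then have "((\<xi> + B \<bullet> B) *\<^sub>R d - (d \<bullet> B) *\<^sub>R B) \<bullet> d = (\<xi>' - \<xi>) * (v' \<bullet> d)"
    by simp
  then have "\<xi> * (d \<bullet> d) + ((B \<bullet> B) * (d \<bullet> d) - (d \<bullet> B)\<^sup>2) = (\<xi>' - \<xi>) * (v' \<bullet> d)"
    by (simp add: inner_diff_left inner_commute[of B d] power2_eq_square distrib_right)
  then show ?thesis unfolding d_def[symmetric] using magnetic_form_nonneg[of B d]
    by linarith
qed

lemma momentum_inj: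
  assumes "momentum \<xi> v B = momentum \<xi> v' B" and "0 < \<xi>"
  shows "v = v'"
  proof -
  have "(v - v') \<bullet> (v - v') \<le> 0"
    using momentum_eq_diff[OF assms(1)] assms(2) by (simp add: mult_le_0_iff)
  then show ?thesis by (metis inner_gt_zero_iff not_le right_minus_eq)
qed

text \<open>
  For fixed momentum and magnetic field, a larger enthalpy means a smaller speed: by
  \<open>momentum_eq_diff\<close>, \<open>v' \<bullet> (v - v') \<ge> 0\<close>.
\<close>

lemma speed_antimono:
  assumes "momentum \<xi> v B = momentum \<xi>' v' B" and "0 \<le> \<xi>" "\<xi> < \<xi>'"
  shows "v' \<bullet> v' \<le> v \<bullet> v"
proof -
  have "0 \<le> (\<xi>' - \<xi>) * (v' \<bullet> (v - v'))"
    using momentum_eq_diff[OF assms(1,2)] mult_nonneg_nonneg[OF assms(2) inner_ge_zero[of "v - v'"]] by linarith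
  then have "v' \<bullet> v' \<le> v' \<bullet> v"
    using assms(3) by (simp add: zero_le_mult_iff inner_diff_right)
  moreover have "0 \<le> (v - v') \<bullet> (v - v')" by simp
  then have "2 * (v' \<bullet> v) \<le> v \<bullet> v + v' \<bullet> v'" by (simp add: inner_simps inner_commute)
  ultimately show ?thesis by linarith
qed

text \<open>
  The momentum equation turns the increment of the magnetic energy into
  \<open>- (\<xi>' - \<xi>) (v \<bullet> v') / 2 - (\<xi>' v'\<^sup>2 - \<xi> v\<^sup>2) / 2\<close>. With \<open>k = (\<Gamma> - 1) / \<Gamma>\<close> the
  increment of the total energy is then
  \<open>(1 - k) (\<xi>' - \<xi>) - (\<xi>' - \<xi>) (v \<bullet> v') / 2 - (1/2 - k) (\<xi>' v'\<^sup>2 - \<xi> v\<^sup>2)\<close> plus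
  a term that is nonnegative because the speed decreases. As \<open>k \<le> 1/2\<close>, which is
  \<open>\<Gamma> \<le> 2\<close>, and as \<open>\<xi>' v'\<^sup>2 - \<xi> v\<^sup>2 \<le> \<xi>' - \<xi>\<close> and \<open>v \<bullet> v' < 1\<close>, it is positive.
\<close>

lemma total_energy_strict_mono:
  assumes \<Gamma>: "1 < \<Gamma>" "\<Gamma> \<le> 2" and D: "0 \<le> D"
    and mom: "momentum \<xi> v B = momentum \<xi>' v' B" and \<xi>: "0 \<le> \<xi>" "\<xi> < \<xi>'" and v: "norm v < 1"
  shows "total_energy \<Gamma> D v B \<xi> < total_energy \<Gamma> D v' B \<xi>'"
proof -
  define k where "k = (\<Gamma> - 1) / \<Gamma>"
  have k: "0 \<le> k" "k \<le> 1/2" using \<Gamma> by (simp_all add: k_def field_simps)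
  have vv: "v' \<bullet> v' \<le> v \<bullet> v" by (rule speed_antimono[OF mom \<xi>])
  have v1: "v \<bullet> v < 1" using one_minus_inner_self_pos[OF v] by simp
  then have v'1: "v' \<bullet> v' < 1" using vv by simp
  then have nv': "norm v' < 1" unfolding norm_lt_square by simp
  have cross: "v \<bullet> v' < 1" using inner_less_1[of v v'] v nv' by simp
  have kin: "momentum \<xi> v B \<bullet> u = \<xi> * (v \<bullet> u) + (B \<bullet> B) * (v \<bullet> u) - (v \<bullet> B) * (u \<bullet> B)" for \<xi> v u
    by (simp add: momentum_def inner_simps inner_commute algebra_simps)
  have mag: "((B \<bullet> B) * (v' \<bullet> v') - (v' \<bullet> B)\<^sup>2) - ((B \<bullet> B) * (v \<bullet> v) - (v \<bullet> B)\<^sup>2)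
      = - (\<xi>' - \<xi>) * (v \<bullet> v') - (\<xi>' * (v' \<bullet> v') - \<xi> * (v \<bullet> v))"
    using kin[of \<xi> v v] kin[of \<xi> v v'] kin[of \<xi>' v' v] kin[of \<xi>' v' v'] mom
    by (simp add: inner_commute power2_eq_square algebra_simps)
  have root: "0 \<le> k * D * (sqrt (1 - v' \<bullet> v') - sqrt (1 - v \<bullet> v))"
    using k D vv by (intro mult_nonneg_nonneg) auto
  have "\<xi>' * (v' \<bullet> v') - \<xi> * (v \<bullet> v) \<le> (\<xi>' - \<xi>) * (v' \<bullet> v')"
    using mult_left_mono[OF vv \<xi>(1)] by (simp add: algebra_simps)
  also have "\<dots> \<le> \<xi>' - \<xi>" by (rule mult_left_le) (use v'1 \<xi>(2) in auto)
  finally have quad: "(1/2 - k) * (\<xi>' * (v' \<bullet> v') - \<xi> * (v \<bullet> v)) \<le> (1/2 - k) * (\<xi>' - \<xi>)"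
    using k by (intro mult_left_mono) auto
  have less: "(\<xi>' - \<xi>) * (v \<bullet> v') < \<xi>' - \<xi>" using cross \<xi>(2) by simp
  have split: "(1 - k) * (\<xi>' - \<xi>) = (\<xi>' - \<xi>) / 2 + (1/2 - k) * (\<xi>' - \<xi>)"
    by (simp add: field_simps)
  have combine: "0 < P - C / 2 - Y + r" if "P = t / 2 + T" "Y \<le> T" "0 \<le> r" "C < t" for P C Y r t T :: real
    using that by simp
  have "0 < (1 - k) * (\<xi>' - \<xi>) - (\<xi>' - \<xi>) * (v \<bullet> v') / 2
      - (1/2 - k) * (\<xi>' * (v' \<bullet> v') - \<xi> * (v \<bullet> v)) + k * D * (sqrt (1 - v' \<bullet> v') - sqrt (1 - v \<bullet> v))"
    by (rule combine[OF split quad root less])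
  also have "\<dots> = total_energy \<Gamma> D v' B \<xi>' - total_energy \<Gamma> D v B \<xi>"
    using mag unfolding total_energy_def gas_pressure_def k_def[symmetric] by (simp add: field_simps)
  finally show ?thesis by simp
qed

lemma inj_conservative:
  assumes "1 < \<Gamma>" "\<Gamma> \<le> 2"
  shows "inj_on (conservative \<Gamma>) prim_admissible"
proof (rule inj_onI)
  fix V V' :: state
  assume "V \<in> prim_admissible" "V' \<in> prim_admissible" and eq: "conservative \<Gamma> V = conservative \<Gamma> V'"
  then obtain \<rho> v B p \<rho>' v' B' p' where V: "V = (\<rho>, v, B, p)" "V' = (\<rho>', v', B', p')"
    and pos: "0 < \<rho>" "0 < p" "norm v < 1" "0 < \<rho>'" "0 < p'" "norm v' < 1"
    by (auto simp: prim_admissible_def)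
  define D where "D = \<rho> * lorentz v"
  define \<xi> \<xi>' where "\<xi> = \<rho> * enthalpy \<Gamma> \<rho> p * (lorentz v)\<^sup>2" and "\<xi>' = \<rho>' * enthalpy \<Gamma> \<rho>' p' * (lorentz v')\<^sup>2"
  note c = conservative_eq[OF assms(1) pos(1-3), folded D_def \<xi>_def]
  note c' = conservative_eq[OF assms(1) pos(4-6), folded \<xi>'_def]
  have B: "B' = B" and D: "\<rho>' * lorentz v' = D" and mom: "momentum \<xi> v B = momentum \<xi>' v' B"
    and en: "total_energy \<Gamma> D v B \<xi> = total_energy \<Gamma> D v' B \<xi>'"
    using eq c(1)[of B] c'(1)[of B'] by (auto simp: V)
  have "\<not> \<xi> < \<xi>'" "\<not> \<xi>' < \<xi>"
    using total_energy_strict_mono[OF assms _ mom _ _ pos(3), of D]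
      total_energy_strict_mono[OF assms _ mom[symmetric] _ _ pos(6), of D] en c(5,6) c'(6) by auto
  then have "\<xi>' = \<xi>" by simp
  then have "v' = v" using momentum_inj[of \<xi> v B v'] mom c(6) by simp
  then show "V = V'" using c(2,3) c'(2)[unfolded D] c'(3)[unfolded D] B \<open>\<xi>' = \<xi>\<close> by (simp add: V)
qed

lemma primitive_conservative:
  assumes "1 < \<Gamma>" "\<Gamma> \<le> 2" "V \<in> prim_admissible"
  shows "primitive \<Gamma> (conservative \<Gamma> V) = V"
  unfolding primitive_def using inj_conservative[OF assms(1,2)] assms(3) by (rule inv_into_f_f)

section \<open>Admissibility from affine inequalities\<close>

text \<open>
  The inverse of \<open>\<lambda>v. momentum \<xi> v B\<close> for \<open>\<xi> > 0\<close>.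
\<close>

definition velocity :: "real^3 \<Rightarrow> real^3 \<Rightarrow> real \<Rightarrow> real^3" where
  "velocity m B \<xi> = (1 / (\<xi> + B \<bullet> B)) *\<^sub>R (m + ((m \<bullet> B) / \<xi>) *\<^sub>R B)"

lemma momentum_velocity:
  assumes "0 < \<xi>"
  shows "momentum \<xi> (velocity m B \<xi>) B = m"
proof -
  have pos: "0 < \<xi> + B \<bullet> B" using assms by (simp add: add_pos_nonneg)
  have "m \<bullet> B + (m \<bullet> B) / \<xi> * (B \<bullet> B) = (\<xi> + B \<bullet> B) * ((m \<bullet> B) / \<xi>)"
    using assms by (simp add: field_simps)
  then have "velocity m B \<xi> \<bullet> B = (\<xi> + B \<bullet> B) * ((m \<bullet> B) / \<xi>) / (\<xi> + B \<bullet> B)"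
    by (simp add: velocity_def inner_add_left)
  then have "velocity m B \<xi> \<bullet> B = (m \<bullet> B) / \<xi>" using pos by simp
  then show ?thesis using pos by (simp add: momentum_def velocity_def)
qed

lemma momentum_speed_bound:
  assumes "0 \<le> \<xi>"
  shows "\<xi> * norm v \<le> norm (momentum \<xi> v B)"
proof (cases "v = 0")
  case False
  have "\<xi> * (v \<bullet> v) + ((B \<bullet> B) * (v \<bullet> v) - (v \<bullet> B)\<^sup>2) = momentum \<xi> v B \<bullet> v"
    by (simp add: momentum_def inner_diff_left inner_commute[of B v] power2_eq_square distrib_right)
  then have "\<xi> * (v \<bullet> v) \<le> norm (momentum \<xi> v B) * norm v"
    using magnetic_form_nonneg[of B v] norm_cauchy_schwarz[of "momentum \<xi> v B" v] by linarith
  then have "(\<xi> * norm v) * norm v \<le> norm (momentum \<xi> v B) * norm v"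
    by (simp add: power2_norm_eq_inner[symmetric] power2_eq_square mult.assoc)
  then show ?thesis using False by simp
qed simp

text \<open>
  A pressureless state with density \<open>D\<close> and momentum \<open>m\<close>: the condition
  \<open>\<xi> sqrt (1 - v \<bullet> v) = D\<close> says \<open>\<xi> = D W\<close>. Along \<open>v = velocity m B \<xi>\<close> the quantity
  \<open>\<xi>\<^sup>2 (1 - v \<bullet> v)\<close> is at most \<open>D\<^sup>2\<close> at \<open>\<xi> = D\<close>, and at least \<open>D\<^sup>2\<close> at
  \<open>\<xi>\<^sup>2 = D\<^sup>2 + m \<bullet> m\<close> because \<open>\<xi> * norm v \<le> norm m\<close>.
\<close>

lemma cold_state_exists:
  assumes D: "0 < D"
  obtains \<xi> v where "D \<le> \<xi>" "norm v < 1" "momentum \<xi> v B = m" "\<xi> * sqrt (1 - v \<bullet> v) = D"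
proof -
  define g where "g \<xi> = \<xi>\<^sup>2 * (1 - velocity m B \<xi> \<bullet> velocity m B \<xi>)" for \<xi>
  define \<xi>1 where "\<xi>1 = sqrt (D\<^sup>2 + m \<bullet> m)"
  have \<xi>1: "D \<le> \<xi>1" using D by (simp add: \<xi>1_def real_le_rsqrt)
  have cont: "continuous_on {D..\<xi>1} g"
    unfolding g_def velocity_def using D
    by (intro continuous_intros) (auto simp: add_pos_nonneg order_less_imp_not_eq2)
  have lo: "g D \<le> D\<^sup>2" by (simp add: g_def mult_left_le)
  have "\<xi>1 * norm (velocity m B \<xi>1) \<le> norm m"
    using momentum_speed_bound[of \<xi>1 "velocity m B \<xi>1" B] momentum_velocity[of \<xi>1 m B] D \<xi>1 by simp
  then have "(\<xi>1 * norm (velocity m B \<xi>1))\<^sup>2 \<le> (norm m)\<^sup>2"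
    using D \<xi>1 by (intro power_mono) auto
  then have hi: "D\<^sup>2 \<le> g \<xi>1"
    by (simp add: g_def \<xi>1_def power_mult_distrib power2_norm_eq_inner algebra_simps)
  obtain \<xi> where \<xi>: "D \<le> \<xi>" "\<xi> \<le> \<xi>1" "g \<xi> = D\<^sup>2"
    using IVT'[OF lo hi \<xi>1 cont] by blast
  define v where "v = velocity m B \<xi>"
  have "0 < \<xi>\<^sup>2 * (1 - v \<bullet> v)" using \<xi>(3) D by (simp add: g_def v_def)
  then have c: "0 < 1 - v \<bullet> v" using \<xi>(1) D by (simp add: zero_less_mult_iff)
  have "sqrt (g \<xi>) = D" using \<xi>(3) D by simp
  then have "\<xi> * sqrt (1 - v \<bullet> v) = D"
    using \<xi>(1) D by (simp add: g_def v_def real_sqrt_mult)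
  moreover have "norm v < 1" using c unfolding norm_lt_square by simp
  moreover have "momentum \<xi> v B = m" using momentum_velocity \<xi>(1) D by (simp add: v_def)
  ultimately show thesis using that \<xi>(1) by blast
qed

text \<open>
  Up to the factor \<open>lorentz w\<close> this is the density of the energy measured by an observer with
  velocity \<open>w\<close>, minus the density of rest mass and minus the magnetic interaction with the
  field \<open>Bs\<close>. The vector paired with \<open>B\<close> is the magnetic field \<open>Bs\<close> in comoving form, that
  is, the spatial part of the magnetic four-vector of \<open>(w, Bs)\<close> divided by \<open>lorentz w\<close>.
\<close>

definition test_functional :: "real^3 \<Rightarrow> real^3 \<Rightarrow> state \<Rightarrow> real" where
  "test_functional w Bs = (\<lambda>(D, m, B, E). E - D * sqrt (1 - w \<bullet> w) - m \<bullet> w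
     - B \<bullet> ((1 - w \<bullet> w) *\<^sub>R Bs + (w \<bullet> Bs) *\<^sub>R w))"

text \<open>
  The functional with \<open>(w, Bs) = (v, B)\<close> vanishes, up to its constant \<open>p_mag v B\<close>, at the
  pressureless state with velocity \<open>v\<close> and field \<open>B\<close>. As \<open>E\<close> enters with coefficient 1, it
  measures by how much \<open>E\<close> exceeds the energy of that state.
\<close>

lemma test_functional_at_cold_state:
  assumes v: "norm v < 1" and \<xi>: "\<xi> * sqrt (1 - v \<bullet> v) = D"
  shows "test_functional v B (D, momentum \<xi> v B, B, E) + p_mag v B = E - total_energy \<Gamma> D v B \<xi>"
proof -
  have c: "0 < 1 - v \<bullet> v" by (rule one_minus_inner_self_pos[OF v])
  have "D * sqrt (1 - v \<bullet> v) = \<xi> * (sqrt (1 - v \<bullet> v) * sqrt (1 - v \<bullet> v))"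
    by (simp only: \<xi>[symmetric] mult.assoc)
  then have D: "D * sqrt (1 - v \<bullet> v) = \<xi> * (1 - v \<bullet> v)" using c by simp
  show ?thesis
    unfolding test_functional_def total_energy_def gas_pressure_def D p_mag_eq[OF v] momentum_def prod.case
    by (simp add: inner_simps inner_commute power2_eq_square field_simps)
qed

text \<open>
  Follow \<open>v = velocity m B \<xi>\<close> from the pressureless state \<open>\<xi>0\<close> upwards. The speed decreases,
  so \<open>\<xi> sqrt (1 - v \<bullet> v)\<close> exceeds \<open>D\<close> and the pressure is positive. The energy is below \<open>E\<close>
  at \<open>\<xi>0\<close> by the hypothesis, and it is at least \<open>\<xi> / 2\<close>, as the pressure is at most
  \<open>(\<Gamma> - 1) / \<Gamma> * \<xi> \<le> \<xi> / 2\<close>; so it equals \<open>E\<close> at some \<open>\<xi> > \<xi>0\<close>.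
\<close>

lemma admissible_if_test_functional_pos:
  assumes \<Gamma>: "1 < \<Gamma>" "\<Gamma> \<le> 2" and D: "0 < D"
    and pos: "\<And>w Bs. norm w < 1 \<Longrightarrow> 0 < test_functional w Bs (D, m, B, E) + p_mag w Bs"
  shows "(D, m, B, E) \<in> admissible \<Gamma>"
proof -
  obtain \<xi>0 v0 where 0: "D \<le> \<xi>0" "norm v0 < 1" "momentum \<xi>0 v0 B = m" "\<xi>0 * sqrt (1 - v0 \<bullet> v0) = D"
    by (rule cold_state_exists[OF D])
  have \<xi>0: "0 < \<xi>0" using 0(1) D by simp
  have v0: "velocity m B \<xi>0 = v0"
    by (rule momentum_inj[where B = B, OF _ \<xi>0]) (simp add: momentum_velocity[OF \<xi>0] 0(3))
  define f where "f \<xi> = total_energy \<Gamma> D (velocity m B \<xi>) B \<xi>" for \<xi>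
  have slower: "velocity m B \<xi> \<bullet> velocity m B \<xi> \<le> v0 \<bullet> v0" if "\<xi>0 \<le> \<xi>" for \<xi>
  proof (cases "\<xi> = \<xi>0")
    case False
    then show ?thesis using that speed_antimono[of \<xi>0 v0 B \<xi> "velocity m B \<xi>"] \<xi>0 0(3)
      by (simp add: momentum_velocity)
  qed (simp add: v0)
  have lo: "f \<xi>0 < E"
    using pos[OF 0(2), of B] test_functional_at_cold_state[OF 0(2,4), of B E \<Gamma>] by (simp add: f_def v0 0(3))
  define \<xi>1 where "\<xi>1 = max \<xi>0 (2 * E)"
  have hi: "E \<le> f \<xi>1"
  proof -
    define v where "v = velocity m B \<xi>1"
    have c: "0 < 1 - v \<bullet> v"
      using slower[of \<xi>1] one_minus_inner_self_pos[OF 0(2)] by (simp add: v_def \<xi>1_def)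
    have \<xi>1: "0 < \<xi>1" using \<xi>0 by (simp add: \<xi>1_def)
    have "\<xi>1 * (1 - v \<bullet> v) - D * sqrt (1 - v \<bullet> v) \<le> \<xi>1 * (1 - v \<bullet> v)"
      using D c by simp
    also have "\<dots> \<le> \<xi>1" using \<xi>1 by (simp add: mult_left_le)
    finally have "gas_pressure \<Gamma> D v \<xi>1 \<le> (\<Gamma> - 1) / \<Gamma> * \<xi>1"
      unfolding gas_pressure_def using \<Gamma> by (intro mult_left_mono) auto
    also have "\<dots> \<le> 1/2 * \<xi>1"
      using \<Gamma> \<xi>1 by (intro mult_right_mono) (auto simp: field_simps)
    finally have "gas_pressure \<Gamma> D v \<xi>1 \<le> \<xi>1 / 2" by simp
    moreover have "2 * E \<le> \<xi>1" by (simp add: \<xi>1_def)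
    ultimately have "E \<le> \<xi>1 - gas_pressure \<Gamma> D v \<xi>1" by linarith
    also have "0 \<le> (B \<bullet> B) * (1 + v \<bullet> v) - (v \<bullet> B)\<^sup>2"
      using magnetic_form_nonneg[of B v] inner_ge_zero[of B] unfolding distrib_left by linarith
    then have "\<xi>1 - gas_pressure \<Gamma> D v \<xi>1 \<le> total_energy \<Gamma> D v B \<xi>1"
      unfolding total_energy_def by (simp only: le_add_same_cancel1 divide_nonneg_pos zero_less_numeral)
    finally show ?thesis unfolding f_def v_def .
  qed
  have cont: "continuous_on {\<xi>0..\<xi>1} f"
    unfolding f_def total_energy_def gas_pressure_def velocity_def using \<xi>0
    by (intro continuous_intros) (auto simp: add_pos_nonneg order_less_imp_not_eq2)
  obtain \<xi> where \<xi>: "\<xi>0 \<le> \<xi>" "f \<xi> = E"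
    using IVT'[OF less_imp_le[OF lo] hi _ cont] by (auto simp: \<xi>1_def)
  then have less: "\<xi>0 < \<xi>" using lo by (cases "\<xi> = \<xi>0") auto
  define v where "v = velocity m B \<xi>"
  have vv: "v \<bullet> v \<le> v0 \<bullet> v0" using slower[OF \<xi>(1)] by (simp add: v_def)
  have c0: "0 < 1 - v0 \<bullet> v0" by (rule one_minus_inner_self_pos[OF 0(2)])
  have v: "norm v < 1" using vv c0 unfolding norm_lt_square by simp
  have "D \<le> \<xi>0 * sqrt (1 - v \<bullet> v)"
    using vv \<xi>0 unfolding 0(4)[symmetric] by simp
  also have "\<dots> < \<xi> * sqrt (1 - v \<bullet> v)"
    using less one_minus_inner_self_pos[OF v] by simp
  finally have "(D, momentum \<xi> v B, B, total_energy \<Gamma> D v B \<xi>) \<in> admissible \<Gamma>"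
    by (rule admissibleI[OF \<Gamma>(1) D v])
  then show ?thesis
    using \<xi> \<xi>0 by (simp add: v_def momentum_velocity f_def[symmetric])
qed

lemma linear_test_functional: "linear (test_functional w Bs)"
  by (rule linearI) (auto simp: test_functional_def inner_simps algebra_simps split: prod.split)

section \<open>The scaled normals of a convex polygon\<close>

text \<open>
  Rotation by a right angle, clockwise.
\<close>

definition perp :: "real^2 \<Rightarrow> real^2" where
  "perp e = vector [e $ 2, - (e $ 1)]"

lemma linear_perp: "linear perp"
  by (rule linearI) (auto simp: perp_def vec_eq_iff forall_2)

lemma norm_perp [simp]: "norm (perp e) = norm e"
  by (simp add: perp_def norm_eq_sqrt_inner inner_vec_def sum_2 add.commute)

lemma perp_inner_swap: "perp e \<bullet> f = - (perp f \<bullet> e)"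
  by (simp add: perp_def inner_vec_def sum_2)

lemma orthogonal_eq_scaled_perp:
  fixes a e :: "real^2"
  assumes "e \<noteq> 0" "a \<bullet> e = 0"
  obtains c where "a = c *\<^sub>R perp e"
proof
  have ee: "e \<bullet> e \<noteq> 0" using assms(1) by simp
  have "(e \<bullet> e) *\<^sub>R a = (a \<bullet> perp e) *\<^sub>R perp e + (a \<bullet> e) *\<^sub>R e"
    by (simp add: vec_eq_iff forall_2 perp_def inner_vec_def sum_2 algebra_simps)
  then have "(1 / (e \<bullet> e)) *\<^sub>R (e \<bullet> e) *\<^sub>R a = (1 / (e \<bullet> e)) *\<^sub>R (a \<bullet> perp e) *\<^sub>R perp e"
    using assms(2) by simp
  then show "a = ((a \<bullet> perp e) / (e \<bullet> e)) *\<^sub>R perp e" using ee by simp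
qed

lemma cyclic_successor:
  assumes "3 \<le> J" "j < J"
  shows "Suc j mod J < J" "Suc j mod J \<noteq> j" "Suc (Suc j mod J) mod J \<noteq> j"
  using assms by (auto simp: mod_Suc split: if_splits)

lemma convex_polygon_edge_nonzero:
  assumes poly: "convex_polygon J x" and j: "j < J"
  shows "next_vertex J x j \<noteq> x j"
proof -
  have J: "3 \<le> J" using poly by (simp add: convex_polygon_def)
  define k where "k = Suc j mod J"
  note k = cyclic_successor[OF J j, folded k_def]
  obtain a where "\<forall>i<J. i \<noteq> k \<and> i \<noteq> Suc k mod J \<longrightarrow> a \<bullet> (x i - x k) < 0"
    using poly k(1) unfolding convex_polygon_def by blast
  then have "a \<bullet> (x j - x k) < 0" using j k by metis
  then show ?thesis by (auto simp: next_vertex_def k_def)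
qed

text \<open>
  Each scaled normal \<open>edge_length J x j *\<^sub>R N j\<close> is the rotated edge \<open>perp (e j)\<close> up to a
  sign, and the edges sum to zero. It remains to see that the sign is the same for all
  edges, i.e. that the polygon has a fixed orientation. For consecutive edges \<open>j\<close> and
  \<open>s j\<close>, outwardness of \<open>N j\<close> against the end of the next edge and of \<open>N (s j)\<close> against the
  start of the previous one shows that both signs are opposite to that of the one number
  \<open>perp (e j) \<bullet> e (s j)\<close>.
\<close>

lemma sum_scaled_normals_eq_0:
  assumes poly: "convex_polygon J x"
    and N: "\<And>j. j < J \<Longrightarrow> unit_outward_normal J x j (N j)"
  shows "(\<Sum>j<J. edge_length J x j *\<^sub>R N j) = 0"
proof -
  have J: "3 \<le> J" using poly by (simp add: convex_polygon_def)
  define s where "s j = Suc j mod J" for j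
  note sJ = cyclic_successor(1)[OF J, folded s_def] and s1 = cyclic_successor(2,3)[OF J, folded s_def]
  define e where "e j = x (s j) - x j" for j
  have side: "\<exists>a. a \<bullet> e j = 0 \<and> (\<forall>k<J. k \<noteq> j \<and> k \<noteq> s j \<longrightarrow> a \<bullet> (x k - x j) < 0)" if "j < J" for j
    using poly that unfolding convex_polygon_def next_vertex_def e_def s_def by blast
  have e0: "e j \<noteq> 0" if "j < J" for j
    using convex_polygon_edge_nonzero[OF poly that] by (simp add: next_vertex_def e_def s_def)
  have n: "norm (N j) = 1" "N j \<bullet> e j = 0" "\<And>k. k < J \<Longrightarrow> N j \<bullet> (x k - x j) \<le> 0" if "j < J" for j
    using N[OF that] unfolding unit_outward_normal_def next_vertex_def e_def s_def
    by (auto intro: hull_inc)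
  have "\<exists>c. N j = c *\<^sub>R perp (e j)" if "j < J" for j
    using orthogonal_eq_scaled_perp[OF e0[OF that] n(2)[OF that]] by blast
  then obtain c where c: "N j = c j *\<^sub>R perp (e j)" if "j < J" for j by metis
  have cl: "\<bar>c j\<bar> * norm (e j) = 1" if "j < J" for j
    using n(1)[OF that] c[OF that] by simp
  have turn: "c j * (perp (e j) \<bullet> e (s j)) < 0" "c (s j) * (perp (e j) \<bullet> e (s j)) < 0" if j: "j < J" for j
  proof -
    have cross: "perp (e j) \<bullet> e (s j) \<noteq> 0"
    proof
      assume 0: "perp (e j) \<bullet> e (s j) = 0"
      \<comment> \<open>The vertex after the edge is strictly off its line, so consecutive edges are not parallel.\<close>
      obtain a where a: "a \<bullet> e j = 0" "a \<bullet> (x (s (s j)) - x j) < 0"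
        using side[OF j] sJ[OF sJ[OF j]] s1(2)[OF j] s1(1)[OF sJ[OF j]] by blast
      obtain d where d: "a = d *\<^sub>R perp (e j)" using orthogonal_eq_scaled_perp[OF e0[OF j] a(1)] .
      have "a \<bullet> e (s j) = 0" using 0 by (simp add: d)
      moreover have "x (s (s j)) - x j = e j + e (s j)" by (simp add: e_def)
      ultimately show False using a by (simp add: inner_add_right)
    qed
    have c0: "c j \<noteq> 0" "c (s j) \<noteq> 0" using cl[OF j] cl[OF sJ[OF j]] by auto
    have "x (s (s j)) - x j = e j + e (s j)" by (simp add: e_def)
    then have "N j \<bullet> e (s j) \<le> 0"
      using n(3)[OF j sJ[OF sJ[OF j]]] n(2)[OF j] by (simp add: inner_add_right)
    then show "c j * (perp (e j) \<bullet> e (s j)) < 0"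
      using c[OF j] c0 cross by (simp add: order.strict_iff_order)
    have "N (s j) \<bullet> (x j - x (s j)) \<le> 0" by (rule n(3)[OF sJ[OF j] j])
    then have "0 \<le> N (s j) \<bullet> e j" by (simp add: e_def inner_diff_right)
    then have "c (s j) * (perp (e j) \<bullet> e (s j)) \<le> 0"
      using c[OF sJ[OF j]] perp_inner_swap[of "e j" "e (s j)"] by simp
    then show "c (s j) * (perp (e j) \<bullet> e (s j)) < 0"
      using c0 cross by (simp add: order.strict_iff_order)
  qed
  have sgn_step: "sgn (c (s j)) = sgn (c j)" if "j < J" for j
    using turn[OF that] by (auto simp: mult_less_0_iff)
  have sgn: "j < J \<Longrightarrow> sgn (c j) = sgn (c 0)" for j
  proof (induction j)
    case (Suc j)
    then show ?case using sgn_step[of j] by (simp add: s_def)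
  qed simp
  have "edge_length J x j *\<^sub>R N j = sgn (c 0) *\<^sub>R perp (e j)" if j: "j < J" for j
  proof -
    have "edge_length J x j *\<^sub>R N j = (norm (e j) * c j) *\<^sub>R perp (e j)"
      using c[OF j] by (simp add: edge_length_def next_vertex_def e_def s_def dist_norm norm_minus_commute)
    also have "norm (e j) * c j = sgn (c j) * (\<bar>c j\<bar> * norm (e j))"
      by (simp add: sgn_mult_abs[of "c j"] mult.assoc[symmetric])
    finally show ?thesis using cl[OF j] sgn[OF j] by simp
  qed
  then have "(\<Sum>j<J. edge_length J x j *\<^sub>R N j) = (\<Sum>j<J. sgn (c 0) *\<^sub>R perp (e j))"
    by (intro sum.cong) auto
  also have "\<dots> = sgn (c 0) *\<^sub>R perp (\<Sum>j<J. e j)"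
    by (simp add: linear_sum[OF linear_perp] scaleR_sum_right)
  also have "(\<Sum>j<J. e j) = 0"
  proof -
    obtain n where n: "J = Suc n" using J by (cases J) auto
    have "(\<Sum>j<J. x (s j)) = (\<Sum>j<n. x (Suc j)) + x 0" by (simp add: n s_def)
    also have "\<dots> = (\<Sum>j<J. x j)" unfolding n sum.lessThan_Suc_shift by simp
    finally show ?thesis by (simp add: e_def sum_subtractf)
  qed
  finally show ?thesis by (simp add: linear_0[OF linear_perp])
qed

section \<open>The flux and the theorem\<close>

text \<open>
  The flux \<open>\<Sum>k. a $ k *\<^sub>R flux \<Gamma> k\<close> in the direction \<open>a\<close>, as a function of the primitive
  variables.
\<close>

definition primitive_flux :: "real \<Rightarrow> real^3 \<Rightarrow> state \<Rightarrow> state" where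
  "primitive_flux \<Gamma> a = (\<lambda>(\<rho>, v, B, p). case conservative \<Gamma> (\<rho>, v, B, p) of (D, m, _, _) \<Rightarrow>
     (D * (a \<bullet> v),
      (a \<bullet> v) *\<^sub>R m - (a \<bullet> B) *\<^sub>R ((1 - v \<bullet> v) *\<^sub>R B + (v \<bullet> B) *\<^sub>R v) + p_tot v B p *\<^sub>R a,
      (a \<bullet> v) *\<^sub>R B - (a \<bullet> B) *\<^sub>R v,
      a \<bullet> m))"

lemma primitive_flux_eq_sum_flux:
  assumes \<Gamma>: "1 < \<Gamma>" "\<Gamma> \<le> 2" and V: "V \<in> prim_admissible"
  shows "primitive_flux \<Gamma> a V = (\<Sum>k\<in>UNIV. a $ k *\<^sub>R flux \<Gamma> k (conservative \<Gamma> V))"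
proof -
  obtain \<rho> v B p where V': "V = (\<rho>, v, B, p)" by (cases V)
  have v: "norm v < 1" using V by (simp add: V' prim_admissible_def)
  have W: "1 / (lorentz v)\<^sup>2 = 1 - v \<bullet> v"
    using one_minus_inner_self_pos[OF v] by (simp add: lorentz_def power2_norm_eq_inner power_divide)
  obtain D m E where U: "conservative \<Gamma> (\<rho>, v, B, p) = (D, m, B, E)"
    by (simp add: conservative_def Let_def)
  have prim: "primitive \<Gamma> (D, m, B, E) = (\<rho>, v, B, p)"
    using primitive_conservative[OF \<Gamma> V] by (simp add: V' U)
  show ?thesis
    unfolding V' primitive_flux_def U flux_def prim prod.case W
    by (auto simp: sum_3 inner_vec_def vec_eq_iff axis_def forall_3 algebra_simps)
qed

text \<open>
  The terms of the left-hand side separate into the gas and the field contribution. The constant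
  \<open>p_mag w Bs\<close> and the field pressure in \<open>p_tot\<close> belong to the field, and the condition
  \<open>\<rho> h \<ge> \<rho> + 2 p\<close> of \<open>gas_contribution_pos\<close> is \<open>\<Gamma> / (\<Gamma> - 1) \<ge> 2\<close>.
\<close>

lemma test_functional_flux_pos:
  assumes \<Gamma>: "1 < \<Gamma>" "\<Gamma> \<le> 2" and V: "V \<in> prim_admissible"
    and a: "norm a \<le> 1" and w: "norm w < 1"
  shows "0 < test_functional w Bs (conservative \<Gamma> V + primitive_flux \<Gamma> a V) + (1 + a \<bullet> w) * p_mag w Bs
     - (a \<bullet> magnetic (conservative \<Gamma> V)) * (w \<bullet> Bs)"
proof -
  obtain \<rho> v B p where V': "V = (\<rho>, v, B, p)" by (cases V)
  have pos: "0 < \<rho>" "0 < p" "norm v < 1" using V by (simp_all add: V' prim_admissible_def)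
  define D where "D = \<rho> * lorentz v"
  define \<xi> where "\<xi> = \<rho> * enthalpy \<Gamma> \<rho> p * (lorentz v)\<^sup>2"
  note c = conservative_eq[OF \<Gamma>(1) pos, folded D_def \<xi>_def]
  define q where "q = ((B \<bullet> B) * (1 - v \<bullet> v) + (v \<bullet> B)\<^sup>2) / 2"
  define qs where "qs = ((Bs \<bullet> Bs) * (1 - w \<bullet> w) + (w \<bullet> Bs)\<^sup>2) / 2"
  define m where "m = (B \<bullet> B) *\<^sub>R v - (v \<bullet> B) *\<^sub>R B"
  define b where "b = (1 - v \<bullet> v) *\<^sub>R B + (v \<bullet> B) *\<^sub>R v"
  define bs where "bs = (1 - w \<bullet> w) *\<^sub>R Bs + (w \<bullet> Bs) *\<^sub>R w"
  have energy: "total_energy \<Gamma> D v B \<xi> = \<xi> - p + (B \<bullet> B - q)"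
    unfolding total_energy_def c(2) q_def by (simp add: field_simps)
  have mom: "momentum \<xi> v B = \<xi> *\<^sub>R v + m"
    unfolding momentum_def m_def by (simp add: algebra_simps)
  have "2 * p \<le> \<Gamma> / (\<Gamma> - 1) * p"
    using \<Gamma> pos by (intro mult_right_mono) (auto simp: field_simps)
  then have "D * sqrt (1 - v \<bullet> v) + 2 * p \<le> \<xi> * (1 - v \<bullet> v)"
    unfolding c(3,4) by simp
  then have gas: "0 < (1 + a \<bullet> v) * (\<xi> * (1 - v \<bullet> w) - D * sqrt (1 - w \<bullet> w)) - p * (1 + a \<bullet> w)"
    using gas_contribution_pos[OF pos(3) w a pos(2)] c(5) by simp
  have mag: "0 \<le> B \<bullet> B - q + a \<bullet> m
     - (m + (a \<bullet> v) *\<^sub>R m - (a \<bullet> B) *\<^sub>R b + q *\<^sub>R a) \<bullet> w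
     - (B + (a \<bullet> v) *\<^sub>R B - (a \<bullet> B) *\<^sub>R v) \<bullet> bs
     + (1 + a \<bullet> w) * qs - (a \<bullet> B) * (w \<bullet> Bs)"
    unfolding m_def q_def qs_def b_def bs_def
    by (rule field_contribution_nonneg) (use a w in auto)
  have "test_functional w Bs (conservative \<Gamma> V + primitive_flux \<Gamma> a V) + (1 + a \<bullet> w) * p_mag w Bs
     - (a \<bullet> magnetic (conservative \<Gamma> V)) * (w \<bullet> Bs)
    = ((1 + a \<bullet> v) * (\<xi> * (1 - v \<bullet> w) - D * sqrt (1 - w \<bullet> w)) - p * (1 + a \<bullet> w))
     + (B \<bullet> B - q + a \<bullet> m
     - (m + (a \<bullet> v) *\<^sub>R m - (a \<bullet> B) *\<^sub>R b + q *\<^sub>R a) \<bullet> w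
     - (B + (a \<bullet> v) *\<^sub>R B - (a \<bullet> B) *\<^sub>R v) \<bullet> bs
     + (1 + a \<bullet> w) * qs - (a \<bullet> B) * (w \<bullet> Bs))"
    unfolding V' primitive_flux_def c(1) test_functional_def magnetic_def prod.case add_Pair p_tot_def
      p_mag_eq[OF pos(3)] p_mag_eq[OF w] q_def[symmetric] qs_def[symmetric] b_def[symmetric] 
      bs_def[symmetric] energy mom
    by (simp add: inner_simps algebra_simps)
  with gas mag show ?thesis by linarith
qed

lemma density_flux_pos:
  assumes "1 < \<Gamma>" "V \<in> prim_admissible" "norm a \<le> 1"
  shows "0 < fst (conservative \<Gamma> V + primitive_flux \<Gamma> a V)"
proof -
  obtain \<rho> v B p where V: "V = (\<rho>, v, B, p)" by (cases V)
  have pos: "0 < \<rho>" "0 < p" "norm v < 1" using assms(2) by (simp_all add: V prim_admissible_def)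
  have "fst (conservative \<Gamma> V + primitive_flux \<Gamma> a V) = \<rho> * lorentz v * (1 + a \<bullet> v)"
    by (simp add: V primitive_flux_def conservative_def Let_def algebra_simps)
  then show ?thesis
    using conservative_eq(5)[OF assms(1) pos] one_plus_inner_pos[OF pos(3) assms(3)] by simp
qed

theorem theorem2p7:
  fixes \<Gamma> \<alpha> :: real and J L :: nat
    and x N :: "nat \<Rightarrow> real ^ 2" and l \<omega> :: "nat \<Rightarrow> real"
    and U :: "nat \<Rightarrow> nat \<Rightarrow> state"
  assumes "1 < \<Gamma>" and "\<Gamma> \<le> 2"
    and "convex_polygon J x"
    and "\<And>j. j < J \<Longrightarrow> l j = edge_length J x j"
    and "\<And>j. j < J \<Longrightarrow> unit_outward_normal J x j (N j)"
    and "\<And>i. i < L \<Longrightarrow> \<omega> i > 0"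
    and "(\<Sum>i<L. \<omega> i) = 1"
    and "\<And>i j. i < L \<Longrightarrow> j < J \<Longrightarrow> U i j \<in> admissible \<Gamma>"
    and "(\<Sum>j<J. (\<Sum>i<L. \<omega> i * (magnetic (U i j) $ 1 * N j $ 1 + magnetic (U i j) $ 2 * N j $ 2)) * l j) = 0"
    and "\<alpha> \<ge> 1"
  shows "(1 / (\<Sum>j<J. l j)) *\<^sub>R (\<Sum>j<J. l j *\<^sub>R (\<Sum>i<L. \<omega> i *\<^sub>R
           (U i j - (1 / \<alpha>) *\<^sub>R (N j $ 1 *\<^sub>R flux \<Gamma> 1 (U i j) + N j $ 2 *\<^sub>R flux \<Gamma> 2 (U i j)))))
         \<in> admissible \<Gamma>"
proof -
  note \<Gamma> = assms(1,2)
  \<comment> \<open>The states in the average are \<open>Z i j = U i j + F\<^sub>a\<close> for the direction \<open>a = a j\<close>.\<close>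
  define a :: "nat \<Rightarrow> real^3" where "a j = - (1 / \<alpha>) *\<^sub>R vector [N j $ 1, N j $ 2, 0]" for j
  define Z where "Z i j = U i j - (1 / \<alpha>) *\<^sub>R (N j $ 1 *\<^sub>R flux \<Gamma> 1 (U i j) + N j $ 2 *\<^sub>R flux \<Gamma> 2 (U i j))" for i j
  define S where "S = (\<Sum>j<J. l j *\<^sub>R (\<Sum>i<L. \<omega> i *\<^sub>R Z i j))"
  define ell where "ell = (\<Sum>j<J. l j)"
  have J: "0 < J" using assms(3) by (simp add: convex_polygon_def)
  have L: "0 < L" using assms(7) by (cases L) auto
  have l: "0 < l j" if j: "j < J" for j
    using convex_polygon_edge_nonzero[OF assms(3) j] assms(4)[OF j] by (simp add: edge_length_def)
  have ell: "0 < ell" unfolding ell_def using J l by (intro sum_pos) auto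
  have a: "norm (a j) \<le> 1" if "j < J" for j
  proof -
    have "norm (vector [N j $ 1, N j $ 2, 0] :: real^3) = norm (N j)"
      by (simp add: norm_eq_sqrt_inner inner_vec_def sum_2 sum_3)
    then show ?thesis using assms(5)[OF that] assms(10) by (simp add: a_def unit_outward_normal_def)
  qed
  have V: "\<exists>V \<in> prim_admissible. U i j = conservative \<Gamma> V \<and> Z i j = conservative \<Gamma> V + primitive_flux \<Gamma> (a j) V"
    if ij: "i < L" "j < J" for i j
  proof -
    obtain V where V: "V \<in> prim_admissible" "U i j = conservative \<Gamma> V"
      using assms(8)[OF ij] by (auto simp: admissible_def)
    have "Z i j = conservative \<Gamma> V + primitive_flux \<Gamma> (a j) V"
      unfolding primitive_flux_eq_sum_flux[OF \<Gamma> V(1)] Z_def V(2)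
      by (simp add: sum_3 a_def scaleR_add_right)
    with V show ?thesis by blast
  qed
  have weighted_pos: "0 < (\<Sum>j<J. l j * (\<Sum>i<L. \<omega> i * f i j))"
    if "\<And>i j. i < L \<Longrightarrow> j < J \<Longrightarrow> 0 < f i j" for f
    using that J L l assms(6) by (intro sum_pos mult_pos_pos) auto
  have weighted_linear: "F S = (\<Sum>j<J. l j * (\<Sum>i<L. \<omega> i * F (Z i j)))" if "linear F" for F :: "state \<Rightarrow> real"
    unfolding S_def by (simp add: linear_sum[OF that] linear_cmul[OF that])
  have weighted_normal: "(\<Sum>j<J. l j *\<^sub>R a j) = 0"
  proof -
    have "(\<Sum>j<J. l j *\<^sub>R N j) = 0"
      using sum_scaled_normals_eq_0[OF assms(3,5)] assms(4) by simp
    then have "(\<Sum>j<J. l j * N j $ k) = 0" for k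
      by (simp add: vec_eq_iff sum_component)
    then show ?thesis
      by (simp add: vec_eq_iff forall_3 a_def sum_negf sum_divide_distrib[symmetric])
  qed
  have weighted_field: "(\<Sum>j<J. l j * (\<Sum>i<L. \<omega> i * (a j \<bullet> magnetic (U i j)))) = 0"
  proof -
    have "(\<Sum>j<J. l j * (\<Sum>i<L. \<omega> i * (a j \<bullet> magnetic (U i j))))
      = (\<Sum>j<J. - (1 / \<alpha>) * ((\<Sum>i<L. \<omega> i * (magnetic (U i j) $ 1 * N j $ 1 + magnetic (U i j) $ 2 * N j $ 2)) * l j))"
      by (simp add: a_def inner_vec_def sum_3 sum_distrib_left sum_distrib_right algebra_simps)
    then show ?thesis using assms(9) by (simp only: sum_distrib_left[symmetric])
  qed
  have D: "0 < fst S"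
    unfolding weighted_linear[OF linear_fst]
    using V density_flux_pos[OF \<Gamma>(1) _ a] by (intro weighted_pos) metis
  have pair: "0 < test_functional w Bs S + ell * p_mag w Bs" if w: "norm w < 1" for w Bs
  proof -
    define u where "u j = 1 + a j \<bullet> w" for j
    have "0 < (\<Sum>j<J. l j * (\<Sum>i<L. \<omega> i * (test_functional w Bs (Z i j) + u j * p_mag w Bs
        - (a j \<bullet> magnetic (U i j)) * (w \<bullet> Bs))))"
      unfolding u_def using V test_functional_flux_pos[OF \<Gamma> _ a w] by (intro weighted_pos) metis
    also have "\<dots> = test_functional w Bs S + (\<Sum>j<J. l j * u j) * p_mag w Bs
        - (\<Sum>j<J. l j * (\<Sum>i<L. \<omega> i * (a j \<bullet> magnetic (U i j)))) * (w \<bullet> Bs)"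
    proof -
      have "(\<Sum>i<L. \<omega> i * (u j * p_mag w Bs)) = u j * p_mag w Bs" for j
        using assms(7) by (simp add: sum_distrib_right[symmetric])
      then show ?thesis unfolding weighted_linear[OF linear_test_functional]
        by (simp add: distrib_left right_diff_distrib sum.distrib sum_subtractf sum_distrib_left sum_distrib_right mult.assoc)
    qed
    also have "(\<Sum>j<J. l j * u j) = ell + (\<Sum>j<J. l j *\<^sub>R a j) \<bullet> w"
      by (simp add: u_def ell_def distrib_left sum.distrib inner_sum_left)
    finally show ?thesis by (simp add: weighted_normal weighted_field)
  qed
  obtain D m B E where T: "(1 / ell) *\<^sub>R S = (D, m, B, E)" by (cases "(1 / ell) *\<^sub>R S")
  have "0 < D" using D ell T by (metis fst_conv fst_scaleR real_scaleR_def mult_pos_pos zero_less_divide_1_iff)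
  moreover have "0 < test_functional w Bs (D, m, B, E) + p_mag w Bs" if "norm w < 1" for w Bs
  proof -
    have "test_functional w Bs (D, m, B, E) + p_mag w Bs = (1 / ell) * (test_functional w Bs S + ell * p_mag w Bs)"
      unfolding T[symmetric] linear_cmul[OF linear_test_functional] using ell by (simp add: field_simps)
    then show ?thesis using pair[OF that] ell by simp
  qed
  ultimately have "(D, m, B, E) \<in> admissible \<Gamma>" by (rule admissible_if_test_functional_pos[OF \<Gamma>])
  then show ?thesis unfolding T[symmetric] S_def Z_def ell_def .
qed

end
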